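(* If the strong KKT condition holds at $\widehat{x}\in S$, then $\widehat{x}$ is an efficient solution of $(P)$.
   Context: Setting: $p\geq 2$, $I:=\{1,\ldots,p\}$; $f_i:\mathbb{R}^n\to\mathbb{R}$ ($i\in I$) are finite-valued convex functions; $T$ is an infinite index set; for each $t\in T$, $g_t:\mathbb{R}^n\to\mathbb{R}\cup\{+\infty\}$ is a lower semicontinuous proper convex function. Problem $(P)$: minimize $f(x):=(f_1(x),\ldots,f_p(x))$ subject to $g_t(x)\le 0$, $t\in T$, with feasible set $S:=\{x\in\mathbb{R}^n\mid g_t(x)\le 0\ \forall t\in T\}$ assumed nonempty. $\widehat{x}\in S$ is an efficient solution of $(P)$ if there is no $x\in S$ with $f_i(x)\le f_i(\widehat{x})$ for all $i\in I$ and $f(x)\neq f(\widehat{x})$. The strong KKT condition holds at $\widehat{x}\in S$ when there exist $\alpha_i>0$ ($i\in I$) with $\sum_{i=1}^p\alpha_i=1$, and $\beta_t\ge0$ ($t\in T(\widehat{x})$), with $\beta_t\neq0$ for finitely many indices only, such that $0_n\in\sum_{i=1}^p\alpha_i\partial f_i(\widehat{x})+\sum_{t\in T(\widehat{x})}\beta_t\partial g_t(\widehat{x})$. Here $\partial$ is the Fenchel–Moreau subdifferential and $T(\widehat{x}):=\{t\in T\mid g_t(\widehat{x})=0\}$. *)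

theory Defs
  imports "HOL-Analysis.Analysis"
begin

definition lower_semicontinuous :: "('a::topological_space \<Rightarrow> ereal) \<Rightarrow> bool" where
  "lower_semicontinuous h \<longleftrightarrow> (\<forall>x. h x \<le> Liminf (at x) h)"

definition proper :: "('a \<Rightarrow> ereal) \<Rightarrow> bool" where
  "proper h \<longleftrightarrow> (\<forall>x. h x \<noteq> - \<infinity>) \<and> (\<exists>x. h x \<noteq> \<infinity>)"

(* Convexity of the epigraph; the library's convex_on and epigraph are for
   real-valued functions only. *)
definition convex_ereal :: "('a::real_vector \<Rightarrow> ereal) \<Rightarrow> bool" where
  "convex_ereal h \<longleftrightarrow> convex {(x, r :: real). h x \<le> ereal r}"

(* The subdifferential is empty where h is not finite. *)
definition subdifferential :: "('a::real_inner \<Rightarrow> ereal) \<Rightarrow> 'a \<Rightarrow> 'a set" where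
  "subdifferential h x =
     (if \<bar>h x\<bar> = \<infinity> then {} else {u. \<forall>y. h y \<ge> h x + ereal (u \<bullet> (y - x))})"

definition feasible_set :: "'t set \<Rightarrow> ('t \<Rightarrow> 'a \<Rightarrow> ereal) \<Rightarrow> 'a set" where
  "feasible_set T g = {x. \<forall>t\<in>T. g t x \<le> 0}"

definition active_indices :: "'t set \<Rightarrow> ('t \<Rightarrow> 'a \<Rightarrow> ereal) \<Rightarrow> 'a \<Rightarrow> 't set" where
  "active_indices T g x = {t \<in> T. g t x = 0}"

(* The objective is the vector (f 1 x, ..., f p x); values of f outside {1..p}
   are irrelevant. *)
definition efficient_solution ::
  "nat \<Rightarrow> (nat \<Rightarrow> 'a \<Rightarrow> real) \<Rightarrow> 't set \<Rightarrow> ('t \<Rightarrow> 'a \<Rightarrow> ereal) \<Rightarrow> 'a \<Rightarrow> bool" where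
  "efficient_solution p f T g xh \<longleftrightarrow>
     xh \<in> feasible_set T g \<and>
     \<not> (\<exists>x \<in> feasible_set T g.
          (\<forall>i\<in>{1..p}. f i x \<le> f i xh) \<and> (\<exists>i\<in>{1..p}. f i x \<noteq> f i xh))"

(* Sums and addition of subdifferentials are Minkowski operations on sets
   (HOL-Library.Set_Algebras). The sum over the active indices has finite support:
   indices with zero multiplier contribute {0}, even where the subdifferential
   is empty. *)
definition strong_KKT ::
  "nat \<Rightarrow> (nat \<Rightarrow> 'a::real_inner \<Rightarrow> real) \<Rightarrow> 't set \<Rightarrow> ('t \<Rightarrow> 'a \<Rightarrow> ereal) \<Rightarrow> 'a \<Rightarrow> bool" where
  "strong_KKT p f T g xh \<longleftrightarrow>
     (\<exists>(\<alpha> :: nat \<Rightarrow> real) (\<beta> :: 't \<Rightarrow> real).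
        (\<forall>i\<in>{1..p}. \<alpha> i > 0) \<and> (\<Sum>i\<in>{1..p}. \<alpha> i) = 1 \<and>
        (\<forall>t\<in>active_indices T g xh. \<beta> t \<ge> 0) \<and>
        finite {t \<in> active_indices T g xh. \<beta> t \<noteq> 0} \<and>
        0 \<in> (\<Sum>i\<in>{1..p}. (\<lambda>u. \<alpha> i *\<^sub>R u) ` subdifferential (\<lambda>x. ereal (f i x)) xh)
            + (\<Sum>t\<in>{t \<in> active_indices T g xh. \<beta> t \<noteq> 0}.
                 (\<lambda>u. \<beta> t *\<^sub>R u) ` subdifferential (g t) xh))"

end

theory Submission
  imports Defs
begin

text \<open>
  A subgradient at \<open>xh\<close> bounds the slope of its function in the direction \<open>x - xh\<close> by the
  actual increase of that function. Suppose a feasible \<open>x\<close> is at least as good as \<open>xh\<close> in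
  every objective and differs from it in one. Testing the vector \<open>0\<close> of the strong KKT
  condition against \<open>x - xh\<close> gives
  \<open>0 \<le> (\<Sum>i\<in>{1..p}. \<alpha> i * (f i x - f i xh))\<close>,
  because every active constraint goes from \<open>0\<close> at \<open>xh\<close> to a nonpositive value at \<open>x\<close>, so its
  subgradients have nonpositive inner product with \<open>x - xh\<close>. All the multipliers \<open>\<alpha> i\<close> are
  strictly positive, so the right-hand side is negative: each term is nonpositive and one is
  negative. A multiplier equal to \<open>0\<close> would let the one improved objective escape, and the
  argument would give only weak efficiency.

  The condition speaks of Minkowski sums of sets of subgradients. Bounds on linear functionals
  add up over such sums (\<open>inner_Minkowski_sum_le\<close>), so no individual subgradients have
  to be selected.
\<close>

text \<open>
  This is subadditivity of support functions: a linear functional maps a Minkowski sum to the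
  sum of its values on the summands, so upper bounds add.
\<close>

lemma inner_Minkowski_sum_le:
  fixes A :: "'i \<Rightarrow> 'a::real_inner set"
  assumes "finite I" and "v \<in> (\<Sum>i\<in>I. A i)"
    and "\<And>i u. i \<in> I \<Longrightarrow> u \<in> A i \<Longrightarrow> u \<bullet> d \<le> c i"
  shows "v \<bullet> d \<le> (\<Sum>i\<in>I. c i)"
proof -
  obtain s where v: "v = (\<Sum>i\<in>I. s i)" and s: "\<forall>i\<in>I. s i \<in> A i"
    using assms(2) unfolding set_sum_alt[OF assms(1)] by blast
  show ?thesis
    unfolding v inner_sum_left using s assms(3) by (intro sum_mono) blast
qed

lemma subgradient_real_inner_le:
  assumes "u \<in> subdifferential (\<lambda>x. ereal (h x)) x0"
  shows "u \<bullet> (x - x0) \<le> h x - h x0"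
proof -
  have "ereal (h x0) + ereal (u \<bullet> (x - x0)) \<le> ereal (h x)"
    using assms by (simp add: subdifferential_def)
  then show ?thesis by simp
qed

text \<open>
  Geometrically, subgradients of an active constraint are normal to the feasible set at the
  reference point.
\<close>

lemma active_subgradient_inner_nonpos:
  assumes "t \<in> active_indices T g x0" and "u \<in> subdifferential (g t) x0"
    and "x \<in> feasible_set T g"
  shows "u \<bullet> (x - x0) \<le> 0"
proof -
  have "t \<in> T" and active: "g t x0 = 0"
    using assms(1) by (auto simp: active_indices_def)
  have "ereal (u \<bullet> (x - x0)) \<le> g t x"
    using assms(2) active by (simp add: subdifferential_def)
  also have "\<dots> \<le> 0"
    using assms(3) \<open>t \<in> T\<close> by (simp add: feasible_set_def)
  finally show ?thesis by simp
qed

theorem theorem7: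
  fixes p :: nat
    and f :: "nat \<Rightarrow> real ^ 'n \<Rightarrow> real"
    and T :: "'t set"
    and g :: "'t \<Rightarrow> real ^ 'n \<Rightarrow> ereal"
    and xh :: "real ^ 'n"
  assumes "p \<ge> 2"
    and "\<And>i. i \<in> {1..p} \<Longrightarrow> convex_on UNIV (f i)"
    and "infinite T"
    and "\<And>t. t \<in> T \<Longrightarrow> lower_semicontinuous (g t)"
    and "\<And>t. t \<in> T \<Longrightarrow> proper (g t)"
    and "\<And>t. t \<in> T \<Longrightarrow> convex_ereal (g t)"
    and "feasible_set T g \<noteq> {}"
    and "xh \<in> feasible_set T g"
    and "strong_KKT p f T g xh"
  shows "efficient_solution p f T g xh"
proof -
  obtain \<alpha> \<beta> where \<alpha>: "\<And>i. i \<in> {1..p} \<Longrightarrow> \<alpha> i > 0"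
    and \<beta>: "\<And>t. t \<in> active_indices T g xh \<Longrightarrow> \<beta> t \<ge> 0"
    and fin: "finite {t \<in> active_indices T g xh. \<beta> t \<noteq> 0}"
    and KKT: "0 \<in> (\<Sum>i\<in>{1..p}. (\<lambda>u. \<alpha> i *\<^sub>R u) ` subdifferential (\<lambda>x. ereal (f i x)) xh)
            + (\<Sum>t\<in>{t \<in> active_indices T g xh. \<beta> t \<noteq> 0}.
                 (\<lambda>u. \<beta> t *\<^sub>R u) ` subdifferential (g t) xh)"
    using \<open>strong_KKT p f T g xh\<close> unfolding strong_KKT_def by blast
  obtain v w
    where v: "v \<in> (\<Sum>i\<in>{1..p}. (\<lambda>u. \<alpha> i *\<^sub>R u) ` subdifferential (\<lambda>x. ereal (f i x)) xh)"
      and w: "w \<in> (\<Sum>t\<in>{t \<in> active_indices T g xh. \<beta> t \<noteq> 0}.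
                 (\<lambda>u. \<beta> t *\<^sub>R u) ` subdifferential (g t) xh)"
      and vw: "v + w = 0"
    using KKT by (auto elim!: set_plus_elim)
  have nonneg: "0 \<le> (\<Sum>i\<in>{1..p}. \<alpha> i * (f i x - f i xh))" if x: "x \<in> feasible_set T g" for x
  proof -
    have "v \<bullet> (x - xh) \<le> (\<Sum>i\<in>{1..p}. \<alpha> i * (f i x - f i xh))"
      using v by (rule inner_Minkowski_sum_le[rotated])
        (auto intro!: mult_left_mono subgradient_real_inner_le less_imp_le[OF \<alpha>])
    moreover have "w \<bullet> (x - xh) \<le> (\<Sum>t\<in>{t \<in> active_indices T g xh. \<beta> t \<noteq> 0}. 0)"
      using fin w
      by (rule inner_Minkowski_sum_le)
        (auto intro!: mult_nonneg_nonpos \<beta> intro: active_subgradient_inner_nonpos[OF _ _ x])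
    moreover have "v \<bullet> (x - xh) + w \<bullet> (x - xh) = 0"
      using vw by (simp flip: inner_add_left)
    ultimately show ?thesis by simp
  qed
  have False
    if x: "x \<in> feasible_set T g" and le: "\<forall>i\<in>{1..p}. f i x \<le> f i xh"
      and j: "j \<in> {1..p}" "f j x \<noteq> f j xh" for x j
  proof -
    have "(\<Sum>i\<in>{1..p}. \<alpha> i * (f i x - f i xh)) < (\<Sum>i\<in>{1..p}. 0)"
    proof (rule sum_strict_mono_ex1)
      show "\<forall>i\<in>{1..p}. \<alpha> i * (f i x - f i xh) \<le> 0"
        using le \<alpha> by (auto intro!: mult_nonneg_nonpos less_imp_le[OF \<alpha>])
      have "f j x < f j xh"
        using le j by (simp add: less_le)
      then have "\<alpha> j * (f j x - f j xh) < 0"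
        using \<alpha>[OF j(1)] by (simp add: mult_pos_neg)
      then show "\<exists>i\<in>{1..p}. \<alpha> i * (f i x - f i xh) < 0"
        using j(1) by blast
    qed simp
    then show False using nonneg[OF x] by simp
  qed
  then show ?thesis
    using \<open>xh \<in> feasible_set T g\<close> unfolding efficient_solution_def by blast
qed

end
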